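(* Let $X$ be a compact metric space and $\varphi:\mathbb{T}^+\times X\to X$ a dynamical system. Define ${}^*:\mathsf{Att}(\varphi)\to\mathsf{Rep}(\varphi)$ by $A=\omega(U)\mapsto A^*=\alpha(U^c)$, where $U$ is any attracting neighborhood with $\omega(U)=A$, and ${}^*:\mathsf{Rep}(\varphi)\to\mathsf{Att}(\varphi)$ by $R=\alpha(U)\mapsto R^*=\omega(U^c)$, where $U$ is any repelling neighborhood with $\alpha(U)=R$. These mappings are lattice anti-isomorphisms, and $(A^* )^*=A$ for all $A\in\mathsf{Att}(\varphi)$ and $(R^* )^*=R$ for all $R\in\mathsf{Rep}(\varphi)$.
   Context: $\mathbb{T}$ is $\mathbb{Z}$ or $\mathbb{R}$, $\mathbb{T}^+=\{t\in\mathbb{T}:t\ge0\}$. A dynamical system is a continuous map $\varphi:\mathbb{T}^+\times X\to X$ with $\varphi(0,x)=x$ and $\varphi(t,\varphi(s,x))=\varphi(t+s,x)$ for $s,t\in\mathbb{T}^+$ (no invertibility assumed). For $S\subset X$ and $t<0$, $\varphi(t,S)=\{y\in X:\varphi(-t,y)\in S\}$. $S$ is invariant if $\varphi(t,S)=S$ for all $t\ge0$, forward invariant if $\varphi(t,S)\subset S$ for all $t\ge0$, backward invariant if $\varphi(t,S)\subset S$ for all $t\le0$. $\mathrm{Inv}(U)$ (resp. $\mathrm{Inv}^+(U)$) is the union of all invariant (resp. forward invariant) subsets of $U$; $U^c=X\setminus U$. For $U\subset X$, $\omega(U)=\bigcap_{t\ge0}\mathrm{cl}\big(\bigcup_{s\ge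 t}\varphi(s,U)\big)$ and $\alpha(U)=\bigcap_{t\le0}\mathrm{cl}\big(\bigcup_{s\le t}\varphi(s,U)\big)$. $U$ is an attracting neighborhood if $\omega(U)\subset\mathrm{int}(U)$, a repelling neighborhood if $\alpha(U)\subset\mathrm{int}(U)$. A trapping region is a forward invariant $U$ with $\varphi(\tau,\mathrm{cl}(U))\subset\mathrm{int}(U)$ for some $\tau>0$; an attractor is a set $\mathrm{Inv}(U)$ with $U$ a trapping region; equivalently, a set $\omega(U)$ with $U$ an attracting neighborhood. A repelling region is a backward invariant $U$ with $\varphi(\tau,\mathrm{cl}(U))\subset\mathrm{int}(U)$ for some $\tau<0$; a repeller is a set $\mathrm{Inv}^+(U)$ with $U$ a repelling region; equivalently, a set $\alpha(U)$ with $U$ a repelling neighborhood. The maps in the claim do not depend on the choice of $U$. $\mathsf{Att}(\varphi)$, the set of attractors, is a bounded distributive lattice with $A\vee A'=A\cup A'$, $A\wedge A'=\mathrm{Inv}(A\cap A')$, $0=\varnothing$, $1=\mathrm{Inv}(X)$. $\mathsf{Rep}(\varphi)$, the set of repellers, is a bounded distributive lattice with $\vee=\cup$, $\wedge=\cap$, $0=\varnothing$, $1=X$. A lattice anti-isomorphism is a bijection interchanging $\vee$ with $\wedge$ (and $0$ with $1$). *)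

theory Defs
  imports "HOL-Analysis.Analysis"
begin

text \<open>
  The time set \<open>T\<close> is a subset of the reals (either \<open>\<int>\<close> or all of \<open>\<real>\<close>) and the phase space
  \<open>X\<close> is a subset of a metric space type, carrying the subspace topology; closures and
  interiors are taken relative to \<open>X\<close>. Values of \<open>\<phi>\<close> at negative times or outside of \<open>X\<close>
  are irrelevant.
\<close>

definition dynamical_system ::
    "real set \<Rightarrow> 'a::metric_space set \<Rightarrow> (real \<Rightarrow> 'a \<Rightarrow> 'a) \<Rightarrow> bool" where
  "dynamical_system T X \<phi> \<longleftrightarrow>
     (\<forall>t\<in>T. 0 \<le> t \<longrightarrow> (\<forall>x\<in>X. \<phi> t x \<in> X)) \<and>
     continuous_on ({t\<in>T. 0 \<le> t} \<times> X) (\<lambda>(t, x). \<phi> t x) \<and>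
     (\<forall>x\<in>X. \<phi> 0 x = x) \<and>
     (\<forall>s\<in>T. \<forall>t\<in>T. 0 \<le> s \<longrightarrow> 0 \<le> t \<longrightarrow> (\<forall>x\<in>X. \<phi> t (\<phi> s x) = \<phi> (t + s) x))"

definition cl :: "'a::metric_space set \<Rightarrow> 'a set \<Rightarrow> 'a set" where
  "cl X S = top_of_set X closure_of S"

definition intr :: "'a::metric_space set \<Rightarrow> 'a set \<Rightarrow> 'a set" where
  "intr X S = top_of_set X interior_of S"

definition set_flow ::
    "'a::metric_space set \<Rightarrow> (real \<Rightarrow> 'a \<Rightarrow> 'a) \<Rightarrow> real \<Rightarrow> 'a set \<Rightarrow> 'a set" where
  "set_flow X \<phi> t S = (if 0 \<le> t then \<phi> t ` S else {y\<in>X. \<phi> (- t) y \<in> S})"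

definition invariant ::
    "real set \<Rightarrow> 'a::metric_space set \<Rightarrow> (real \<Rightarrow> 'a \<Rightarrow> 'a) \<Rightarrow> 'a set \<Rightarrow> bool" where
  "invariant T X \<phi> S \<longleftrightarrow> S \<subseteq> X \<and> (\<forall>t\<in>T. 0 \<le> t \<longrightarrow> set_flow X \<phi> t S = S)"

definition forward_invariant ::
    "real set \<Rightarrow> 'a::metric_space set \<Rightarrow> (real \<Rightarrow> 'a \<Rightarrow> 'a) \<Rightarrow> 'a set \<Rightarrow> bool" where
  "forward_invariant T X \<phi> S \<longleftrightarrow> S \<subseteq> X \<and> (\<forall>t\<in>T. 0 \<le> t \<longrightarrow> set_flow X \<phi> t S \<subseteq> S)"

definition backward_invariant ::
    "real set \<Rightarrow> 'a::metric_space set \<Rightarrow> (real \<Rightarrow> 'a \<Rightarrow> 'a) \<Rightarrow> 'a set \<Rightarrow> bool" where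
  "backward_invariant T X \<phi> S \<longleftrightarrow> S \<subseteq> X \<and> (\<forall>t\<in>T. t \<le> 0 \<longrightarrow> set_flow X \<phi> t S \<subseteq> S)"

definition Inv ::
    "real set \<Rightarrow> 'a::metric_space set \<Rightarrow> (real \<Rightarrow> 'a \<Rightarrow> 'a) \<Rightarrow> 'a set \<Rightarrow> 'a set" where
  "Inv T X \<phi> U = \<Union>{S. S \<subseteq> U \<and> invariant T X \<phi> S}"

definition Inv_plus ::
    "real set \<Rightarrow> 'a::metric_space set \<Rightarrow> (real \<Rightarrow> 'a \<Rightarrow> 'a) \<Rightarrow> 'a set \<Rightarrow> 'a set" where
  "Inv_plus T X \<phi> U = \<Union>{S. S \<subseteq> U \<and> forward_invariant T X \<phi> S}"

definition omega_limit ::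
    "real set \<Rightarrow> 'a::metric_space set \<Rightarrow> (real \<Rightarrow> 'a \<Rightarrow> 'a) \<Rightarrow> 'a set \<Rightarrow> 'a set" where
  "omega_limit T X \<phi> U = (\<Inter>t\<in>{t\<in>T. 0 \<le> t}. cl X (\<Union>s\<in>{s\<in>T. t \<le> s}. set_flow X \<phi> s U))"

definition alpha_limit ::
    "real set \<Rightarrow> 'a::metric_space set \<Rightarrow> (real \<Rightarrow> 'a \<Rightarrow> 'a) \<Rightarrow> 'a set \<Rightarrow> 'a set" where
  "alpha_limit T X \<phi> U = (\<Inter>t\<in>{t\<in>T. t \<le> 0}. cl X (\<Union>s\<in>{s\<in>T. s \<le> t}. set_flow X \<phi> s U))"

definition attracting_nbhd ::
    "real set \<Rightarrow> 'a::metric_space set \<Rightarrow> (real \<Rightarrow> 'a \<Rightarrow> 'a) \<Rightarrow> 'a set \<Rightarrow> bool" where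
  "attracting_nbhd T X \<phi> U \<longleftrightarrow> U \<subseteq> X \<and> omega_limit T X \<phi> U \<subseteq> intr X U"

definition repelling_nbhd ::
    "real set \<Rightarrow> 'a::metric_space set \<Rightarrow> (real \<Rightarrow> 'a \<Rightarrow> 'a) \<Rightarrow> 'a set \<Rightarrow> bool" where
  "repelling_nbhd T X \<phi> U \<longleftrightarrow> U \<subseteq> X \<and> alpha_limit T X \<phi> U \<subseteq> intr X U"

definition trapping_region ::
    "real set \<Rightarrow> 'a::metric_space set \<Rightarrow> (real \<Rightarrow> 'a \<Rightarrow> 'a) \<Rightarrow> 'a set \<Rightarrow> bool" where
  "trapping_region T X \<phi> U \<longleftrightarrow>
     forward_invariant T X \<phi> U \<and> (\<exists>\<tau>\<in>T. \<tau> > 0 \<and> set_flow X \<phi> \<tau> (cl X U) \<subseteq> intr X U)"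

definition repelling_region ::
    "real set \<Rightarrow> 'a::metric_space set \<Rightarrow> (real \<Rightarrow> 'a \<Rightarrow> 'a) \<Rightarrow> 'a set \<Rightarrow> bool" where
  "repelling_region T X \<phi> U \<longleftrightarrow>
     backward_invariant T X \<phi> U \<and> (\<exists>\<tau>\<in>T. \<tau> < 0 \<and> set_flow X \<phi> \<tau> (cl X U) \<subseteq> intr X U)"

definition attractors ::
    "real set \<Rightarrow> 'a::metric_space set \<Rightarrow> (real \<Rightarrow> 'a \<Rightarrow> 'a) \<Rightarrow> 'a set set" where
  "attractors T X \<phi> = {Inv T X \<phi> U | U. trapping_region T X \<phi> U}"

definition repellers ::
    "real set \<Rightarrow> 'a::metric_space set \<Rightarrow> (real \<Rightarrow> 'a \<Rightarrow> 'a) \<Rightarrow> 'a set set" where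
  "repellers T X \<phi> = {Inv_plus T X \<phi> U | U. repelling_region T X \<phi> U}"

record 'b bounded_lattice_structure =
  elems :: "'b set"
  join :: "'b \<Rightarrow> 'b \<Rightarrow> 'b"
  meet :: "'b \<Rightarrow> 'b \<Rightarrow> 'b"
  zero :: 'b
  one :: 'b

definition bounded_distributive_lattice :: "'b bounded_lattice_structure \<Rightarrow> bool" where
  "bounded_distributive_lattice L \<longleftrightarrow>
     zero L \<in> elems L \<and> one L \<in> elems L \<and>
     (\<forall>a\<in>elems L. \<forall>b\<in>elems L. join L a b \<in> elems L \<and> meet L a b \<in> elems L) \<and>
     (\<forall>a\<in>elems L. \<forall>b\<in>elems L. join L a b = join L b a \<and> meet L a b = meet L b a) \<and>
     (\<forall>a\<in>elems L. \<forall>b\<in>elems L. \<forall>c\<in>elems L.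
        join L (join L a b) c = join L a (join L b c) \<and>
        meet L (meet L a b) c = meet L a (meet L b c)) \<and>
     (\<forall>a\<in>elems L. \<forall>b\<in>elems L. join L a (meet L a b) = a \<and> meet L a (join L a b) = a) \<and>
     (\<forall>a\<in>elems L. \<forall>b\<in>elems L. \<forall>c\<in>elems L.
        meet L a (join L b c) = join L (meet L a b) (meet L a c)) \<and>
     (\<forall>a\<in>elems L. join L a (zero L) = a \<and> meet L a (one L) = a)"

definition lattice_anti_isomorphism ::
    "'b bounded_lattice_structure \<Rightarrow> 'c bounded_lattice_structure \<Rightarrow> ('b \<Rightarrow> 'c) \<Rightarrow> bool" where
  "lattice_anti_isomorphism L M f \<longleftrightarrow>
     bounded_distributive_lattice L \<and> bounded_distributive_lattice M \<and>
     bij_betw f (elems L) (elems M) \<and>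
     (\<forall>a\<in>elems L. \<forall>b\<in>elems L. f (join L a b) = meet M (f a) (f b)) \<and>
     (\<forall>a\<in>elems L. \<forall>b\<in>elems L. f (meet L a b) = join M (f a) (f b)) \<and>
     f (zero L) = one M \<and> f (one L) = zero M"

definition Att ::
    "real set \<Rightarrow> 'a::metric_space set \<Rightarrow> (real \<Rightarrow> 'a \<Rightarrow> 'a) \<Rightarrow> 'a set bounded_lattice_structure" where
  "Att T X \<phi> = \<lparr>elems = attractors T X \<phi>, join = (\<union>), meet = (\<lambda>A A'. Inv T X \<phi> (A \<inter> A')),
     zero = {}, one = Inv T X \<phi> X\<rparr>"

definition Rep ::
    "real set \<Rightarrow> 'a::metric_space set \<Rightarrow> (real \<Rightarrow> 'a \<Rightarrow> 'a) \<Rightarrow> 'a set bounded_lattice_structure" where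
  "Rep T X \<phi> = \<lparr>elems = repellers T X \<phi>, join = (\<union>), meet = (\<inter>), zero = {}, one = X\<rparr>"

text \<open>
  The description operator makes the two duals meaningful only if the value does not depend
  on the choice of \<open>U\<close>.
\<close>

definition att_dual ::
    "real set \<Rightarrow> 'a::metric_space set \<Rightarrow> (real \<Rightarrow> 'a \<Rightarrow> 'a) \<Rightarrow> 'a set \<Rightarrow> 'a set" where
  "att_dual T X \<phi> A = (THE R. \<exists>U. attracting_nbhd T X \<phi> U \<and> omega_limit T X \<phi> U = A \<and>
     R = alpha_limit T X \<phi> (X - U))"

definition rep_dual ::
    "real set \<Rightarrow> 'a::metric_space set \<Rightarrow> (real \<Rightarrow> 'a \<Rightarrow> 'a) \<Rightarrow> 'a set \<Rightarrow> 'a set" where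
  "rep_dual T X \<phi> R = (THE A. \<exists>U. repelling_nbhd T X \<phi> U \<and> alpha_limit T X \<phi> U = R \<and>
     A = omega_limit T X \<phi> (X - U))"

end

theory Submission
  imports Defs
begin

text \<open>
  Everything is read off from attracting neighborhoods \<open>U\<close> and their basins
  \<open>W(U) = {x. \<exists>t \<ge> 0. \<phi>(t, x) \<in> U}\<close>. For such \<open>U\<close> one has \<open>\<alpha>(X - U) = X - W(U)\<close>, and by
  compactness \<open>\<omega>(U) \<subseteq> \<omega>(V)\<close>, \<open>W(U) \<subseteq> W(V)\<close> and ``\<open>\<phi>(t, U) \<subseteq> V\<close> for all large \<open>t\<close>'' are
  equivalent. Hence \<open>\<omega>(U) \<mapsto> X - W(U)\<close> is a well-defined order-reversing bijection, and it exchanges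
  the lattice operations because \<open>\<omega>\<close> and \<open>W\<close> both turn unions and intersections of attracting
  neighborhoods into joins and meets.
\<close>

text \<open>The maps need be neither injective nor onto, so facts about repellers are not mirror
  images of facts about attractors under time reversal. They are obtained through complements
  instead: preimages commute with complements, and \<open>X - basin U\<close> consists of the points
  whose orbit never meets \<open>U\<close>. Every repeller is brought to this form, after which only
  attracting neighborhoods remain.

  Compactness enters mainly in one shape: a decreasing family of closed sets whose intersection lies
  in an open set has a member inside that set. This makes entry times uniform, for limit sets and
  for basins alike; basins qualify because they are open (an orbit that meets \<open>U\<close> later
  reaches its interior) and contain \<open>closure U\<close>.

  Attractors and repellers are defined by regions but the duals by neighborhoods; the forward orbit
  of an attracting neighborhood is the trapping region that links the two. Distributivity and the
  other laws descend from set algebra, attracting neighborhoods being closed under union and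
  intersection. Of the time set only a subgroup of the reals containing the naturals is needed,
  which treats both cases at once.\<close>

lemma cl_eq_closure:
  assumes "closed X" "S \<subseteq> X"
  shows "cl X S = closure S"
proof -
  have "closure S \<subseteq> X"
    using assms by (simp add: closure_minimal)
  then show ?thesis
    using assms by (auto simp: cl_def closure_of_subtopology Int_absorb1)
qed

lemma intr_subset: "intr X S \<subseteq> S"
  by (simp add: intr_def interior_of_subset)

lemma openin_intr: "openin (top_of_set X) (intr X S)"
  by (simp add: intr_def)

lemma intr_eq: "openin (top_of_set X) G \<Longrightarrow> intr X G = G"
  by (simp add: intr_def interior_of_openin)

lemma intr_mono: "S \<subseteq> S' \<Longrightarrow> intr X S \<subseteq> intr X S'"
  by (simp add: intr_def interior_of_mono)

lemma intr_Int: "intr X (S \<inter> S') = intr X S \<inter> intr X S'"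
  by (simp add: intr_def interior_of_Int)

lemma intr_Diff: "intr X (X - S) = X - cl X S"
  using interior_of_complement[of "top_of_set X" S] by (simp add: intr_def cl_def)

lemma cl_Diff: "cl X (X - S) = X - intr X S"
  using closure_of_complement[of "top_of_set X" S] by (simp add: intr_def cl_def)

subsection \<open>Semiflows on a compact metric space\<close>

locale compact_semiflow =
  fixes T :: "real set" and X :: "'a::metric_space set" and \<phi> :: "real \<Rightarrow> 'a \<Rightarrow> 'a"
  assumes time: "T = \<int> \<or> T = UNIV"
    and compact: "compact X"
    and flow: "dynamical_system T X \<phi>"
begin

abbreviation "\<omega> \<equiv> omega_limit T X \<phi>"
abbreviation "\<alpha> \<equiv> alpha_limit T X \<phi>"
abbreviation "attracting \<equiv> attracting_nbhd T X \<phi>"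
abbreviation "repelling \<equiv> repelling_nbhd T X \<phi>"

definition tail :: "real \<Rightarrow> 'a set \<Rightarrow> 'a set" where
  "tail t U = (\<Union>s\<in>{s\<in>T. t \<le> s}. \<phi> s ` U)"

text \<open>The backward tail at time \<open>-t\<close>, written with nonnegative times so that
  alpha limits fall under the same intersection lemma as omega limits.\<close>

definition pretail :: "real \<Rightarrow> 'a set \<Rightarrow> 'a set" where
  "pretail t U = {x\<in>X. \<exists>s\<in>T. t \<le> s \<and> \<phi> s x \<in> U}"

text \<open>The entry time is uniform over \<open>U\<close>, and the images remain in
  \<open>V\<close> afterwards; in \<open>basin\<close> the time may depend on the point and the
  orbit may leave again.\<close>

definition absorbs :: "'a set \<Rightarrow> 'a set \<Rightarrow> bool" where
  "absorbs V U \<longleftrightarrow> (\<exists>\<tau>\<in>T. 0 \<le> \<tau> \<and> (\<forall>t\<in>T. \<tau> \<le> t \<longrightarrow> \<phi> t ` U \<subseteq> V))"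

definition basin :: "'a set \<Rightarrow> 'a set" where
  "basin U = {x\<in>X. \<exists>t\<in>T. 0 \<le> t \<and> \<phi> t x \<in> U}"

lemma time_zero [simp]: "0 \<in> T"
  and time_of_nat [simp]: "real n \<in> T"
  and time_add: "s \<in> T \<Longrightarrow> t \<in> T \<Longrightarrow> s + t \<in> T"
  and time_diff: "s \<in> T \<Longrightarrow> t \<in> T \<Longrightarrow> s - t \<in> T"
  and time_minus: "- t \<in> T \<longleftrightarrow> t \<in> T"
  using time by auto

lemma closed_space: "closed X"
  using compact by (rule compact_imp_closed)

lemma flow_in: "t \<in> T \<Longrightarrow> 0 \<le> t \<Longrightarrow> x \<in> X \<Longrightarrow> \<phi> t x \<in> X"
  and flow_zero: "x \<in> X \<Longrightarrow> \<phi> 0 x = x"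
  and flow_flow: "s \<in> T \<Longrightarrow> t \<in> T \<Longrightarrow> 0 \<le> s \<Longrightarrow> 0 \<le> t \<Longrightarrow> x \<in> X \<Longrightarrow> \<phi> t (\<phi> s x) = \<phi> (t + s) x"
  using flow by (auto simp: dynamical_system_def)

lemma flow_split: "s \<in> T \<Longrightarrow> t \<in> T \<Longrightarrow> 0 \<le> s \<Longrightarrow> s \<le> t \<Longrightarrow> x \<in> X \<Longrightarrow> \<phi> t x = \<phi> (t - s) (\<phi> s x)"
  using flow_flow[of s "t - s" x] time_diff[of t s] by simp

lemma continuous_flow:
  assumes "t \<in> T" "0 \<le> t"
  shows "continuous_on X (\<phi> t)"
proof -
  have "continuous_on ({t\<in>T. 0 \<le> t} \<times> X) (\<lambda>(t, x). \<phi> t x)"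
    using flow by (simp add: dynamical_system_def)
  then have "continuous_on X ((\<lambda>(t, x). \<phi> t x) \<circ> Pair t)"
    using assms
    by (intro continuous_on_compose continuous_on_Pair continuous_on_const continuous_on_id)
      (auto elim!: continuous_on_subset)
  then show ?thesis
    by (simp add: o_def)
qed

lemma openin_preimage:
  assumes "t \<in> T" "0 \<le> t" "openin (top_of_set X) G"
  shows "openin (top_of_set X) {x\<in>X. \<phi> t x \<in> G}"
proof -
  have "openin (top_of_set X) (X \<inter> \<phi> t -` G)"
    using continuous_openin_preimage[OF continuous_flow, of t X G] assms flow_in by auto
  moreover have "X \<inter> \<phi> t -` G = {x\<in>X. \<phi> t x \<in> G}" by auto
  ultimately show ?thesis by simp
qed

lemma closed_preimage:
  assumes "t \<in> T" "0 \<le> t" "closed C"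
  shows "closed {x\<in>X. \<phi> t x \<in> C}"
proof -
  have "closed (X \<inter> \<phi> t -` C)"
    using continuous_closed_preimage[OF continuous_flow closed_space] assms by auto
  moreover have "X \<inter> \<phi> t -` C = {x\<in>X. \<phi> t x \<in> C}" by auto
  ultimately show ?thesis by simp
qed

lemma closed_image:
  assumes "t \<in> T" "0 \<le> t" "closed C" "C \<subseteq> X"
  shows "closed (\<phi> t ` C)"
proof -
  have "compact C"
    using compact assms by (metis Int_absorb1 compact_Int_closed)
  then show ?thesis
    using assms continuous_flow continuous_on_subset
    by (metis compact_continuous_image compact_imp_closed)
qed

lemma closure_subset_space: "U \<subseteq> X \<Longrightarrow> closure U \<subseteq> X"
  by (simp add: closed_space closure_minimal)

lemma flow_closure:
  assumes "t \<in> T" "0 \<le> t" "U \<subseteq> X"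
  shows "\<phi> t ` closure U \<subseteq> closure (\<phi> t ` U)"
proof (rule image_closure_subset)
  show "continuous_on (closure U) (\<phi> t)"
    using assms continuous_flow closure_subset_space continuous_on_subset by metis
qed (auto simp: closure_subset)

text \<open>For \<open>G = {}\<close> this is Cantor's intersection theorem.\<close>

lemma nested_closed_subset_open:
  assumes "\<And>t. t \<in> T \<Longrightarrow> 0 \<le> t \<Longrightarrow> closed (C t) \<and> C t \<subseteq> X"
    and decr: "\<And>s t. s \<in> T \<Longrightarrow> t \<in> T \<Longrightarrow> 0 \<le> s \<Longrightarrow> s \<le> t \<Longrightarrow> C t \<subseteq> C s"
    and "openin (top_of_set X) G"
    and "(\<Inter>t\<in>{t\<in>T. 0 \<le> t}. C t) \<subseteq> G"
  shows "\<exists>t\<in>T. 0 \<le> t \<and> C t \<subseteq> G"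
proof (rule ccontr)
  assume contr: "\<not> ?thesis"
  obtain G' where G': "open G'" "G = X \<inter> G'"
    using assms(3) by (auto simp: openin_open)
  \<comment> \<open>Natural times lie in \<open>T\<close> in both cases and are cofinal, so they
    determine the intersection. Removing \<open>G'\<close> turns containment in \<open>G\<close>
    into emptiness.\<close>
  define F where "F n = C (real n) - G'" for n
  have *: "closed (C (real n))" "C (real n) \<subseteq> X" for n
    using assms(1) by auto
  have clo: "closed (F n)" for n
    using * G' by (auto simp: F_def)
  have ne: "F n \<noteq> {}" for n
    using contr *[of n] G' time_of_nat[of n] unfolding F_def by force
  have mono: "F n \<subseteq> F m" if "m \<le> n" for m n
    using decr[of "real m" "real n"] that by (auto simp: F_def)
  have "\<exists>x. \<forall>n. x \<in> F n"
  proof (rule ccontr)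
    assume "\<nexists>x. \<forall>n. x \<in> F n"
    then have "X \<subseteq> (\<Union>n\<in>UNIV. - F n)"
      by auto
    then obtain I where I: "finite I" "X \<subseteq> (\<Union>n\<in>I. - F n)"
      using compactE_image[OF compact, of UNIV "\<lambda>n. - F n"] clo by (metis open_Compl)
    obtain m where "\<forall>n\<in>I. n \<le> m"
      using I(1) finite_nat_set_iff_bounded_le by blast
    then have "F m \<inter> X = {}"
      using I(2) mono by blast
    then show False
      using ne *(2) by (force simp: F_def)
  qed
  then obtain x where x: "\<And>n. x \<in> F n"
    by auto
  have "x \<in> C t" if "t \<in> T" "0 \<le> t" for t
  proof -
    obtain n :: nat where "t \<le> real n"
      using real_arch_simple by blast
    then show ?thesis
      using decr[of t "real n"] that x[of n] by (auto simp: F_def)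
  qed
  then have "x \<in> G"
    using assms(4) by auto
  then show False
    using x[of 0] G' by (auto simp: F_def)
qed

section \<open>Limit sets as intersections of closed tails\<close>

lemma tail_subset: "U \<subseteq> X \<Longrightarrow> 0 \<le> t \<Longrightarrow> tail t U \<subseteq> X"
  using flow_in by (auto simp: tail_def)

lemma tail_mono: "s \<le> t \<Longrightarrow> tail t U \<subseteq> tail s U"
  by (auto simp: tail_def)

lemma pretail_subset: "pretail t U \<subseteq> X"
  by (auto simp: pretail_def)

lemma pretail_mono: "s \<le> t \<Longrightarrow> pretail t U \<subseteq> pretail s U"
  unfolding pretail_def by (blast intro: order_trans)

lemma omega_eq:
  assumes "U \<subseteq> X"
  shows "\<omega> U = (\<Inter>t\<in>{t\<in>T. 0 \<le> t}. closure (tail t U))"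
proof -
  have "(\<Union>s\<in>{s\<in>T. t \<le> s}. set_flow X \<phi> s U) = tail t U" if "0 \<le> t" for t
    using that by (auto simp: tail_def set_flow_def)
  then show ?thesis
    using tail_subset[OF assms] by (auto simp: omega_limit_def cl_eq_closure[OF closed_space])
qed

lemma alpha_eq:
  assumes "U \<subseteq> X"
  shows "\<alpha> U = (\<Inter>t\<in>{t\<in>T. 0 \<le> t}. closure (pretail t U))"
proof -
  \<comment> \<open>At \<open>s = 0\<close> the flow of a set is defined as an image; it is also a
    preimage there because time 0 acts as the identity.\<close>
  have sf: "set_flow X \<phi> s U = {x\<in>X. \<phi> (- s) x \<in> U}" if "s \<le> 0" for s
  proof (cases "s = 0")
    case True
    then show ?thesis
      using assms flow_zero by (force simp: set_flow_def)
  qed (use that in \<open>auto simp: set_flow_def\<close>)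
  have "(\<Union>s\<in>{s\<in>T. s \<le> t}. set_flow X \<phi> s U) = pretail (- t) U" if "t \<le> 0" for t
  proof (intro set_eqI iffI)
    fix x assume "x \<in> (\<Union>s\<in>{s\<in>T. s \<le> t}. set_flow X \<phi> s U)"
    then obtain s where "s \<in> T" "s \<le> t" "x \<in> set_flow X \<phi> s U" by auto
    then show "x \<in> pretail (- t) U"
      using that sf[of s] by (auto simp: pretail_def time_minus intro!: bexI[of _ "- s"])
  next
    fix x assume "x \<in> pretail (- t) U"
    then obtain s where "s \<in> T" "- t \<le> s" "\<phi> s x \<in> U" "x \<in> X" by (auto simp: pretail_def)
    then show "x \<in> (\<Union>s\<in>{s\<in>T. s \<le> t}. set_flow X \<phi> s U)"
      using that sf[of "- s"] by (auto simp: time_minus intro!: exI[of _ "- s"])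
  qed
  then have "\<alpha> U = (\<Inter>t\<in>{t\<in>T. t \<le> 0}. closure (pretail (- t) U))"
    by (auto simp: alpha_limit_def cl_eq_closure[OF closed_space pretail_subset])
  also have "\<dots> = (\<Inter>t\<in>{t\<in>T. 0 \<le> t}. closure (pretail t U))"
  proof -
    have "{t\<in>T. 0 \<le> t} = uminus ` {t\<in>T. t \<le> 0}"
    proof (intro set_eqI iffI)
      fix t assume "t \<in> {t\<in>T. 0 \<le> t}"
      then have "t = - (- t)" "- t \<in> {t\<in>T. t \<le> 0}"
        by (auto simp: time_minus)
      then show "t \<in> uminus ` {t\<in>T. t \<le> 0}"
        by (rule image_eqI)
    qed (auto simp: time_minus)
    then show ?thesis
      by (simp add: image_image)
  qed
  finally show ?thesis .
qed

lemma omega_subset_space: "U \<subseteq> X \<Longrightarrow> \<omega> U \<subseteq> X"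
  using closure_subset_space[OF tail_subset[of U 0]] time_zero by (fastforce simp: omega_eq)

subsection \<open>Absorption and basins\<close>

lemma absorbsE:
  assumes "absorbs V U"
  obtains \<tau> where "\<tau> \<in> T" "0 \<le> \<tau>" "\<And>t x. t \<in> T \<Longrightarrow> \<tau> \<le> t \<Longrightarrow> x \<in> U \<Longrightarrow> \<phi> t x \<in> V"
  using assms unfolding absorbs_def by blast

lemma absorbs_subset: "absorbs V U \<Longrightarrow> V \<subseteq> V' \<Longrightarrow> U' \<subseteq> U \<Longrightarrow> absorbs V' U'"
  unfolding absorbs_def by blast

text \<open>A time \<open>s\<close> beyond \<open>t + \<tau>\<close> splits into
  \<open>s - t\<close>, long enough to reach \<open>V\<close>, followed by \<open>t\<close>. A bound
  by the image at one fixed time, rather than by a tail of \<open>V\<close>, survives closure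
  because that image of a compact set is closed.\<close>

lemma absorbs_tail:
  assumes "absorbs V U" "U \<subseteq> X" "V \<subseteq> X"
  obtains \<tau> where "\<tau> \<in> T" "0 \<le> \<tau>" "\<And>t. t \<in> T \<Longrightarrow> 0 \<le> t \<Longrightarrow> tail (t + \<tau>) U \<subseteq> \<phi> t ` V"
proof -
  obtain \<tau> where \<tau>: "\<tau> \<in> T" "0 \<le> \<tau>" "\<And>t x. t \<in> T \<Longrightarrow> \<tau> \<le> t \<Longrightarrow> x \<in> U \<Longrightarrow> \<phi> t x \<in> V"
    using assms(1) by (rule absorbsE) blast
  have "tail (t + \<tau>) U \<subseteq> \<phi> t ` V" if t: "t \<in> T" "0 \<le> t" for t
  proof
    fix y assume "y \<in> tail (t + \<tau>) U"
    then obtain s x where s: "s \<in> T" "t + \<tau> \<le> s" "x \<in> U" "y = \<phi> s x"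
      by (auto simp: tail_def)
    then have "y = \<phi> t (\<phi> (s - t) x)" "\<phi> (s - t) x \<in> V"
      using \<tau> t assms(2) flow_flow[of "s - t" t x] time_diff[of s t] by auto
    then show "y \<in> \<phi> t ` V" by blast
  qed
  with \<tau> that show ?thesis by blast
qed

lemma absorbs_imp_omega_subset:
  assumes "absorbs V U" "U \<subseteq> X" "V \<subseteq> X"
  shows "\<omega> U \<subseteq> \<omega> V"
proof -
  obtain \<tau> where \<tau>: "\<tau> \<in> T" "0 \<le> \<tau>" "\<And>t. t \<in> T \<Longrightarrow> 0 \<le> t \<Longrightarrow> tail (t + \<tau>) U \<subseteq> \<phi> t ` V"
    using absorbs_tail[OF assms] by metis
  have "\<omega> U \<subseteq> closure (tail t V)" if "t \<in> T" "0 \<le> t" for t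
  proof -
    have "tail (t + \<tau>) U \<subseteq> tail t V"
      using \<tau>(3)[OF that] that by (force simp: tail_def)
    moreover have "\<omega> U \<subseteq> closure (tail (t + \<tau>) U)"
      using omega_eq[OF assms(2)] \<tau> that time_add by force
    ultimately show ?thesis
      using closure_mono by blast
  qed
  then show ?thesis
    using omega_eq[OF assms(3)] by auto
qed

text \<open>The closed tails decrease to the limit set, so compactness puts one of them inside
  \<open>G\<close>; continuity then extends the capture from \<open>U\<close> to its
  closure.\<close>

lemma omega_subset_open_imp_absorbs:
  assumes "U \<subseteq> X" "openin (top_of_set X) G" "\<omega> U \<subseteq> G"
  shows "absorbs G (closure U)"
proof -
  obtain \<tau> where \<tau>: "\<tau> \<in> T" "0 \<le> \<tau>" "closure (tail \<tau> U) \<subseteq> G"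
  proof -
    have "\<exists>t\<in>T. 0 \<le> t \<and> closure (tail t U) \<subseteq> G"
      using assms omega_eq[OF assms(1)] tail_subset[OF assms(1)] closure_subset_space
      by (intro nested_closed_subset_open[of "\<lambda>t. closure (tail t U)"] closure_mono tail_mono) auto
    with that show ?thesis by blast
  qed
  have "\<phi> t ` closure U \<subseteq> G" if "t \<in> T" "\<tau> \<le> t" for t
  proof -
    have "\<phi> t ` closure U \<subseteq> closure (\<phi> t ` U)"
      using that \<tau> assms(1) by (intro flow_closure) auto
    also have "\<phi> t ` U \<subseteq> tail \<tau> U"
      using that by (auto simp: tail_def)
    finally show ?thesis
      using \<tau>(3) by (meson closure_mono subset_trans)
  qed
  with \<tau> show ?thesis
    unfolding absorbs_def by blast
qed

text \<open>The working form of attraction: one time after which \<open>closure U\<close> stays in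
  the interior. Conversely, absorption confines a late tail to the image of \<open>closure U\<close>
  at time \<open>\<tau>\<close>, which is closed and lies in the interior.\<close>

lemma attracting_iff:
  "attracting U \<longleftrightarrow> U \<subseteq> X \<and> absorbs (intr X U) (closure U)"
proof (intro iffI conjI)
  assume "attracting U"
  then show "U \<subseteq> X" "absorbs (intr X U) (closure U)"
    by (auto simp: attracting_nbhd_def intro!: omega_subset_open_imp_absorbs openin_intr)
next
  assume *: "U \<subseteq> X \<and> absorbs (intr X U) (closure U)"
  then obtain \<tau> where \<tau>: "\<tau> \<in> T" "0 \<le> \<tau>"
    "\<And>t x. t \<in> T \<Longrightarrow> \<tau> \<le> t \<Longrightarrow> x \<in> closure U \<Longrightarrow> \<phi> t x \<in> intr X U"
    by (elim conjE absorbsE) blast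
  obtain \<sigma> where \<sigma>: "\<sigma> \<in> T" "0 \<le> \<sigma>" "\<And>t. t \<in> T \<Longrightarrow> 0 \<le> t \<Longrightarrow> tail (t + \<sigma>) U \<subseteq> \<phi> t ` U"
  proof -
    have "absorbs U U"
      using * by (meson absorbs_subset closure_subset intr_subset)
    then show ?thesis
      using absorbs_tail * that by blast
  qed
  have "\<omega> U \<subseteq> closure (tail (\<tau> + \<sigma>) U)"
    using * omega_eq \<tau> \<sigma> time_add by auto
  also have "\<dots> \<subseteq> \<phi> \<tau> ` closure U"
    using \<sigma>(3)[OF \<tau>(1,2)] closed_image[OF \<tau>(1,2) closed_closure closure_subset_space, of U] *
      closure_subset[of U]
    by (intro closure_minimal) blast+
  also have "\<dots> \<subseteq> intr X U"
    using \<tau>(1,3) by auto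
  finally show "attracting U"
    using * by (simp add: attracting_nbhd_def)
qed

lemma attracting_subset: "attracting U \<Longrightarrow> U \<subseteq> X"
  by (simp add: attracting_nbhd_def)

lemma attractingE:
  assumes "attracting U"
  obtains \<tau> where "\<tau> \<in> T" "0 \<le> \<tau>"
    "\<And>t x. t \<in> T \<Longrightarrow> \<tau> \<le> t \<Longrightarrow> x \<in> closure U \<Longrightarrow> \<phi> t x \<in> intr X U"
  using assms unfolding attracting_iff by (elim conjE absorbsE) blast

lemma basin_absorbs_subset:
  assumes "absorbs V U" "U \<subseteq> X"
  shows "basin U \<subseteq> basin V"
proof
  obtain \<tau> where \<tau>: "\<tau> \<in> T" "0 \<le> \<tau>" "\<And>t x. t \<in> T \<Longrightarrow> \<tau> \<le> t \<Longrightarrow> x \<in> U \<Longrightarrow> \<phi> t x \<in> V"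
    using assms(1) by (rule absorbsE) blast
  fix x assume "x \<in> basin U"
  then obtain t where t: "x \<in> X" "t \<in> T" "0 \<le> t" "\<phi> t x \<in> U"
    by (auto simp: basin_def)
  then have "\<phi> (\<tau> + t) x \<in> V"
    using \<tau>(3)[of \<tau> "\<phi> t x"] flow_flow[of t \<tau> x] \<tau> by auto
  then show "x \<in> basin V"
    using t \<tau> time_add[of \<tau> t] by (auto simp: basin_def intro!: bexI[of _ "\<tau> + t"])
qed

text \<open>An orbit that meets \<open>U\<close> is in its interior at all late times. Written this
  way the basin is visibly open in \<open>X\<close>, which the compactness arguments need.\<close>

lemma basin_eq_open_Union:
  assumes "attracting U"
  shows "basin U = (\<Union>t\<in>{t\<in>T. 0 \<le> t}. {x\<in>X. \<phi> t x \<in> intr X U})"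
proof -
  have "absorbs (intr X U) U"
    using assms closure_subset by (auto simp: attracting_iff intro: absorbs_subset)
  then have "basin U \<subseteq> basin (intr X U)"
    using assms by (intro basin_absorbs_subset attracting_subset)
  moreover have "basin (intr X U) \<subseteq> basin U"
    using intr_subset[of X U] by (auto simp: basin_def)
  ultimately show ?thesis
    by (auto simp: basin_def)
qed

lemma closure_subset_basin:
  assumes "attracting U"
  shows "closure U \<subseteq> basin U"
proof -
  obtain \<tau> where "\<tau> \<in> T" "0 \<le> \<tau>"
    "\<And>t x. t \<in> T \<Longrightarrow> \<tau> \<le> t \<Longrightarrow> x \<in> closure U \<Longrightarrow> \<phi> t x \<in> intr X U"
    using assms by (rule attractingE) blast
  then show ?thesis
    using closure_subset_space[OF attracting_subset[OF assms]]
    by (force simp: basin_eq_open_Union[OF assms])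
qed

text \<open>Each point of \<open>closure U\<close> enters the interior of \<open>V\<close> at some
  time of its own; compactness of \<open>closure U\<close> bounds these times.\<close>

lemma basin_subset_imp_absorbs:
  assumes U: "attracting U" and V: "attracting V" and "basin U \<subseteq> basin V"
  shows "absorbs V U"
proof -
  obtain \<tau> where \<tau>: "\<tau> \<in> T" "0 \<le> \<tau>"
    "\<And>t x. t \<in> T \<Longrightarrow> \<tau> \<le> t \<Longrightarrow> x \<in> closure V \<Longrightarrow> \<phi> t x \<in> intr X V"
    using V by (rule attractingE) blast
  \<comment> \<open>Entry by time \<open>t\<close>, not at time \<open>t\<close>, so that these open
    sets increase with \<open>t\<close>.\<close>
  define E where "E t = {x\<in>X. \<exists>s\<in>T. 0 \<le> s \<and> s \<le> t \<and> \<phi> s x \<in> intr X V}" for t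
  have "\<exists>t\<in>T. 0 \<le> t \<and> closure U - E t \<subseteq> {}"
  proof (rule nested_closed_subset_open[of "\<lambda>t. closure U - E t"])
    fix t
    have "E t = (\<Union>s\<in>{s\<in>T. 0 \<le> s \<and> s \<le> t}. {x\<in>X. \<phi> s x \<in> intr X V})"
      by (auto simp: E_def)
    then have "openin (top_of_set X) (E t)"
      by (auto intro!: openin_preimage openin_intr)
    then obtain G where "open G" "E t = X \<inter> G"
      by (auto simp: openin_open)
    then have "closure U - E t = closure U - G"
      using closure_subset_space[OF attracting_subset[OF U]] by auto
    then show "closed (closure U - E t) \<and> closure U - E t \<subseteq> X"
      using \<open>open G\<close> closure_subset_space[OF attracting_subset[OF U]] by auto
  next
    fix s t :: real assume "s \<le> t"
    then show "closure U - E t \<subseteq> closure U - E s"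
      by (force simp: E_def)
  next
    show "(\<Inter>t\<in>{t\<in>T. 0 \<le> t}. closure U - E t) \<subseteq> {}"
    proof
      fix x assume x: "x \<in> (\<Inter>t\<in>{t\<in>T. 0 \<le> t}. closure U - E t)"
      then have "x \<in> closure U"
        using time_zero by blast
      then have "x \<in> basin V"
        using closure_subset_basin[OF U] assms(3) by auto
      then obtain t where "t \<in> T" "0 \<le> t" "x \<in> E t"
        by (auto simp: basin_eq_open_Union[OF V] E_def)
      with x show "x \<in> {}" by blast
    qed
  qed auto
  then obtain \<sigma> where \<sigma>: "\<sigma> \<in> T" "0 \<le> \<sigma>" "closure U \<subseteq> E \<sigma>"
    by auto
  \<comment> \<open>Entry may take up to \<open>\<sigma>\<close>; the remaining time is at least
    \<open>\<tau>\<close>, after which points of \<open>V\<close> no longer leave it.\<close>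
  have "\<phi> t ` U \<subseteq> V" if t: "t \<in> T" "\<tau> + \<sigma> \<le> t" for t
  proof
    fix y assume "y \<in> \<phi> t ` U"
    then obtain x where x: "x \<in> U" "y = \<phi> t x" by auto
    then have "x \<in> E \<sigma>"
      using \<sigma>(3) closure_subset by auto
    then obtain s where s: "x \<in> X" "s \<in> T" "0 \<le> s" "s \<le> \<sigma>" "\<phi> s x \<in> intr X V"
      by (auto simp: E_def)
    then have "\<phi> s x \<in> closure V"
      using intr_subset closure_subset by (metis subsetD)
    then have "\<phi> (t - s) (\<phi> s x) \<in> intr X V"
      using \<tau> s t by (intro \<tau>(3) time_diff) auto
    moreover have "y = \<phi> (t - s) (\<phi> s x)"
      using x s t \<tau> by (auto intro!: flow_split)
    ultimately show "y \<in> V"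
      using intr_subset by (metis subsetD)
  qed
  then show ?thesis
    using \<tau> \<sigma> time_add unfolding absorbs_def by (metis add_nonneg_nonneg)
qed

lemma omega_subset_iff:
  assumes U: "attracting U" and V: "attracting V"
  shows "\<omega> U \<subseteq> \<omega> V \<longleftrightarrow> basin U \<subseteq> basin V"
proof
  assume "\<omega> U \<subseteq> \<omega> V"
  then have "\<omega> U \<subseteq> intr X V"
    using V by (auto simp: attracting_nbhd_def)
  then have "absorbs V U"
    by (meson U absorbs_subset attracting_subset closure_subset intr_subset
        omega_subset_open_imp_absorbs openin_intr)
  then show "basin U \<subseteq> basin V"
    using U attracting_subset basin_absorbs_subset by blast
next
  assume "basin U \<subseteq> basin V"
  then show "\<omega> U \<subseteq> \<omega> V"
    using U V absorbs_imp_omega_subset attracting_subset basin_subset_imp_absorbs by blast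
qed

lemma omega_eq_iff: "attracting U \<Longrightarrow> attracting V \<Longrightarrow> \<omega> U = \<omega> V \<longleftrightarrow> basin U = basin V"
  by (simp add: set_eq_subset omega_subset_iff)

text \<open>A point that never meets \<open>U\<close> lies in every backward tail of
  \<open>X - U\<close>. For a point of the basin a whole neighborhood is needed, as the tails are
  closed up: near it, all points are in the interior of \<open>U\<close> at one time
  \<open>t\<close>, hence in \<open>U\<close> from \<open>t + \<tau>\<close> on, so the neighborhood
  misses a late backward tail.\<close>

lemma alpha_compl:
  assumes "attracting U"
  shows "\<alpha> (X - U) = X - basin U"
proof -
  have eq: "\<alpha> (X - U) = (\<Inter>t\<in>{t\<in>T. 0 \<le> t}. closure (pretail t (X - U)))"
    by (rule alpha_eq) auto
  obtain \<tau> where \<tau>: "\<tau> \<in> T" "0 \<le> \<tau>"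
    "\<And>t x. t \<in> T \<Longrightarrow> \<tau> \<le> t \<Longrightarrow> x \<in> closure U \<Longrightarrow> \<phi> t x \<in> intr X U"
    using assms by (rule attractingE) blast
  show ?thesis
  proof (intro subset_antisym subsetI)
    fix x assume x: "x \<in> \<alpha> (X - U)"
    then have "x \<in> X"
      using eq closure_subset_space[OF pretail_subset, of 0] time_zero by force
    moreover have "x \<notin> basin U"
    proof
      assume "x \<in> basin U"
      then obtain t where t: "t \<in> T" "0 \<le> t" "\<phi> t x \<in> intr X U"
        by (auto simp: basin_eq_open_Union[OF assms])
      obtain G where G: "open G" "{x\<in>X. \<phi> t x \<in> intr X U} = X \<inter> G"
        using openin_preimage[OF t(1,2) openin_intr, of U] by (auto simp: openin_open)
      have "G \<inter> pretail (t + \<tau>) (X - U) = {}"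
      proof (rule ccontr)
        assume "G \<inter> pretail (t + \<tau>) (X - U) \<noteq> {}"
        then obtain y s where y: "y \<in> X" "y \<in> G" "s \<in> T" "t + \<tau> \<le> s" "\<phi> s y \<notin> U"
          by (auto simp: pretail_def)
        then have "\<phi> t y \<in> closure U"
          using G(2) intr_subset closure_subset by blast
        then have "\<phi> (s - t) (\<phi> t y) \<in> intr X U"
          using \<tau> y t by (intro \<tau>(3) time_diff) auto
        then show False
          using y t \<tau> flow_split[of t s y] intr_subset[of X U] by auto
      qed
      then have "G \<inter> closure (pretail (t + \<tau>) (X - U)) = {}"
        using G(1) by (simp add: open_Int_closure_eq_empty)
      moreover have "x \<in> closure (pretail (t + \<tau>) (X - U))"
        using x eq t \<tau> time_add by auto
      moreover have "x \<in> G"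
        using G(2) t \<open>x \<in> X\<close> by auto
      ultimately show False by auto
    qed
    ultimately show "x \<in> X - basin U" by auto
  next
    fix x assume "x \<in> X - basin U"
    then have "x \<in> pretail t (X - U)" if "t \<in> T" "0 \<le> t" for t
      using that flow_in by (auto simp: basin_def pretail_def)
    then show "x \<in> \<alpha> (X - U)"
      unfolding eq using closure_subset by fastforce
  qed
qed

text \<open>Complementing \<open>closure U \<subseteq> basin U\<close> gives exactly the required
  inclusion.\<close>

lemma repelling_compl:
  assumes "attracting U"
  shows "repelling (X - U)"
proof -
  have "X - basin U \<subseteq> X - cl X U"
    using closure_subset_basin[OF assms] attracting_subset[OF assms]
    by (auto simp: cl_eq_closure[OF closed_space])
  then show ?thesis
    using alpha_compl[OF assms] by (auto simp: repelling_nbhd_def intr_Diff)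
qed

subsection \<open>Repelling neighborhoods\<close>

lemma repelling_tail:
  assumes "repelling V"
  obtains \<tau> where "\<tau> \<in> T" "0 \<le> \<tau>" "closure (pretail \<tau> V) \<subseteq> intr X V"
proof -
  have V: "V \<subseteq> X" "\<alpha> V \<subseteq> intr X V"
    using assms by (auto simp: repelling_nbhd_def)
  have "\<exists>t\<in>T. 0 \<le> t \<and> closure (pretail t V) \<subseteq> intr X V"
    using V alpha_eq[OF V(1)] closure_subset_space[OF pretail_subset]
    by (intro nested_closed_subset_open[of "\<lambda>t. closure (pretail t V)"] closure_mono pretail_mono
        openin_intr) auto
  with that show ?thesis by blast
qed

text \<open>The complement of a repelling neighborhood \<open>V\<close> need not be an attracting neighborhood:
  if \<open>\<phi>\<close> is constant with value \<open>p\<close> at all positive integer times, then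
  \<open>V = X - {p}\<close> is repelling with \<open>\<alpha> V = {}\<close>, but \<open>{p}\<close> may have empty interior.
  Hence the complement is fattened first.\<close>

lemma repelling_dual_attracting:
  assumes "repelling V"
  obtains N where "attracting N" "\<omega> N = \<omega> (X - V)" "\<alpha> V = X - basin N"
    "\<alpha> V = {x\<in>X. \<forall>t\<in>T. 0 \<le> t \<longrightarrow> \<phi> t x \<in> V}"
proof -
  obtain \<tau> where \<tau>: "\<tau> \<in> T" "0 \<le> \<tau>" "closure (pretail \<tau> V) \<subseteq> intr X V"
    using assms by (rule repelling_tail)
  have V: "V \<subseteq> X"
    using assms by (simp add: repelling_nbhd_def)
  \<comment> \<open>The closed set \<open>C\<close> lies in the interior of \<open>V\<close>, so its
    complement \<open>N\<close> is open and contains \<open>closure (X - V)\<close>.\<close>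
  define C where "C = closure (pretail \<tau> V)"
  define N where "N = X - C"
  have C: "C \<subseteq> X" "C \<subseteq> intr X V" "C \<subseteq> V" "closed C" "X - N = C"
    using \<tau>(3) intr_subset[of X V] V by (auto simp: C_def N_def)
  have "openin (top_of_set X) N"
    using C(4) by (auto simp: N_def openin_open intro!: exI[of _ "- C"])
  then have intN: "intr X N = N"
    by (rule intr_eq)
  \<comment> \<open>Being outside the backward tail means avoiding \<open>V\<close> from time
    \<open>\<tau>\<close> on.\<close>
  have step: "\<phi> t x \<in> X - V" if "t \<in> T" "\<tau> \<le> t" "x \<in> N" for t x
  proof -
    have "x \<in> X" "x \<notin> pretail \<tau> V"
      using that closure_subset by (auto simp: N_def C_def)
    then show ?thesis
      using that flow_in \<tau> by (auto simp: pretail_def)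
  qed
  have XVN: "closure (X - V) \<subseteq> N"
    using cl_Diff[of X V] C(2) by (auto simp: cl_eq_closure[OF closed_space] N_def)
  have abs: "absorbs (X - V) N"
    using \<tau> step by (auto simp: absorbs_def)
  have "attracting N"
  proof -
    have "\<phi> t ` closure N \<subseteq> N" if "t \<in> T" "\<tau> \<le> t" for t
    proof -
      have "\<phi> t ` closure N \<subseteq> closure (\<phi> t ` N)"
        using that \<tau> by (intro flow_closure) (auto simp: N_def)
      also have "\<dots> \<subseteq> closure (X - V)"
        using step that by (intro closure_mono) auto
      finally show ?thesis
        using XVN by auto
    qed
    then show ?thesis
      unfolding attracting_iff intN absorbs_def using \<tau> by (auto simp: N_def)
  qed
  moreover have "\<omega> N = \<omega> (X - V)"
  proof
    show "\<omega> N \<subseteq> \<omega> (X - V)"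
      using abs by (intro absorbs_imp_omega_subset) (auto simp: N_def)
    have "absorbs N N"
      using abs XVN closure_subset by (meson absorbs_subset subset_refl subset_trans)
    then have "absorbs N (X - V)"
      using XVN closure_subset by (meson absorbs_subset subset_refl subset_trans)
    then show "\<omega> (X - V) \<subseteq> \<omega> N"
      by (intro absorbs_imp_omega_subset) (auto simp: N_def)
  qed
  moreover have "\<alpha> V = X - basin N"
  proof -
    \<comment> \<open>\<open>C\<close> lies in \<open>V\<close>, and an orbit in \<open>V\<close> at
      some time beyond \<open>t + \<tau>\<close> is in \<open>C\<close> at time \<open>t\<close>.
      Shifting the tails by \<open>\<tau>\<close> does not change their intersection.\<close>
    have "\<alpha> V = \<alpha> C"
    proof
      show "\<alpha> C \<subseteq> \<alpha> V"
      proof -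
        have "pretail t C \<subseteq> pretail t V" for t
          using C(3) by (auto simp: pretail_def)
        then show ?thesis
          unfolding alpha_eq[OF V] alpha_eq[OF C(1)] by (intro INF_mono' closure_mono)
      qed
      have "\<alpha> V \<subseteq> closure (pretail t C)" if t: "t \<in> T" "0 \<le> t" for t
      proof -
        have "pretail (t + \<tau>) V \<subseteq> pretail t C"
        proof
          fix x assume "x \<in> pretail (t + \<tau>) V"
          then obtain s where s: "x \<in> X" "s \<in> T" "t + \<tau> \<le> s" "\<phi> s x \<in> V"
            by (auto simp: pretail_def)
          then have "\<phi> t x \<in> pretail \<tau> V"
            using t \<tau> flow_split[of t s x] flow_in[of t x] time_diff[of s t]
            by (auto simp: pretail_def intro!: bexI[of _ "s - t"])
          then show "x \<in> pretail t C"
            using t s closure_subset by (auto simp: pretail_def[of t] C_def)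
        qed
        moreover have "\<alpha> V \<subseteq> closure (pretail (t + \<tau>) V)"
          using alpha_eq[OF V] t \<tau> time_add by auto
        ultimately show ?thesis
          using closure_mono by blast
      qed
      then show "\<alpha> V \<subseteq> \<alpha> C"
        using alpha_eq[OF C(1)] by auto
    qed
    then show ?thesis
      using alpha_compl[OF \<open>attracting N\<close>] C(5) by simp
  qed
  moreover have "X - basin N = {x\<in>X. \<forall>t\<in>T. 0 \<le> t \<longrightarrow> \<phi> t x \<in> V}"
  proof (intro subset_antisym subsetI)
    fix x assume "x \<in> X - basin N"
    then show "x \<in> {x\<in>X. \<forall>t\<in>T. 0 \<le> t \<longrightarrow> \<phi> t x \<in> V}"
      using C(3) flow_in by (auto simp: basin_def N_def)
  next
    fix x assume x: "x \<in> {x\<in>X. \<forall>t\<in>T. 0 \<le> t \<longrightarrow> \<phi> t x \<in> V}"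
    have "\<phi> t x \<in> C" if "t \<in> T" "0 \<le> t" for t
    proof -
      have "\<phi> t x \<in> pretail \<tau> V"
        using x that \<tau> flow_in flow_flow[of t \<tau> x] time_add[of \<tau> t]
        by (auto simp: pretail_def intro!: bexI[of _ \<tau>])
      then show ?thesis
        using closure_subset by (auto simp: C_def)
    qed
    then show "x \<in> X - basin N"
      using x by (auto simp: basin_def N_def)
  qed
  ultimately show ?thesis
    using that by simp
qed

subsection \<open>Lattice operations\<close>

lemma omega_invariant:
  assumes "U \<subseteq> X"
  shows "invariant T X \<phi> (\<omega> U)"
proof -
  have "\<phi> t ` \<omega> U = \<omega> U" if t: "t \<in> T" "0 \<le> t" for t
  proof
    show "\<phi> t ` \<omega> U \<subseteq> \<omega> U"
    proof -
      have "\<phi> t ` \<omega> U \<subseteq> closure (tail s U)" if s: "s \<in> T" "0 \<le> s" for s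
      proof -
        have "\<phi> t ` \<omega> U \<subseteq> \<phi> t ` closure (tail s U)"
          using s by (auto simp: omega_eq[OF assms])
        also have "\<dots> \<subseteq> closure (\<phi> t ` tail s U)"
          using t s assms by (intro flow_closure tail_subset)
        also have "\<phi> t ` tail s U \<subseteq> tail s U"
        proof
          fix y assume "y \<in> \<phi> t ` tail s U"
          then obtain r x where "r \<in> T" "s \<le> r" "x \<in> U" "y = \<phi> t (\<phi> r x)"
            by (auto simp: tail_def)
          then show "y \<in> tail s U"
            using t s assms flow_flow[of r t x] time_add[of t r]
            by (auto simp: tail_def intro!: exI[of _ "t + r"])
        qed
        finally show ?thesis
          by (meson closure_mono subset_trans)
      qed
      then show ?thesis
        by (auto simp: omega_eq[OF assms])
    qed
  next
    show "\<omega> U \<subseteq> \<phi> t ` \<omega> U"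
    proof
      fix y assume y: "y \<in> \<omega> U"
      \<comment> \<open>One preimage of \<open>y\<close> must lie in all closed tails at once. Each
        closed tail contains some preimage, and nestedness with compactness yields a common
        one.\<close>
      define Q where "Q = {x\<in>X. \<phi> t x \<in> {y}}"
      have "closed Q"
        unfolding Q_def using t by (intro closed_preimage) auto
      have ne: "closure (tail s U) \<inter> Q \<noteq> {}" if s: "s \<in> T" "0 \<le> s" for s
      proof -
        have cs: "closure (tail s U) \<subseteq> X"
          using assms s by (intro closure_subset_space tail_subset)
        have "tail (s + t) U \<subseteq> \<phi> t ` tail s U"
        proof
          fix z assume "z \<in> tail (s + t) U"
          then obtain r x where r: "r \<in> T" "s + t \<le> r" "x \<in> U" "z = \<phi> r x"
            by (auto simp: tail_def)
          then have "z = \<phi> t (\<phi> (r - t) x)"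
            using t s assms flow_flow[of "r - t" t x] time_diff[of r t] by auto
          moreover have "\<phi> (r - t) x \<in> tail s U"
            using r t time_diff[of r t] by (auto simp: tail_def)
          ultimately show "z \<in> \<phi> t ` tail s U" by blast
        qed
        also have "\<dots> \<subseteq> \<phi> t ` closure (tail s U)"
          by (intro image_mono closure_subset)
        finally have "closure (tail (s + t) U) \<subseteq> \<phi> t ` closure (tail s U)"
          using closed_image[OF t closed_closure cs] by (rule closure_minimal)
        moreover have "y \<in> closure (tail (s + t) U)"
          using y s t time_add by (auto simp: omega_eq[OF assms])
        ultimately show ?thesis
          using cs by (auto simp: Q_def)
      qed
      have "\<not> (\<Inter>s\<in>{s\<in>T. 0 \<le> s}. closure (tail s U) \<inter> Q) \<subseteq> {}"
      proof
        assume "(\<Inter>s\<in>{s\<in>T. 0 \<le> s}. closure (tail s U) \<inter> Q) \<subseteq> {}"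
        then have "\<exists>s\<in>T. 0 \<le> s \<and> closure (tail s U) \<inter> Q \<subseteq> {}"
        proof (intro nested_closed_subset_open[of "\<lambda>s. closure (tail s U) \<inter> Q"])
          fix s t :: real assume "s \<le> t"
          then show "closure (tail t U) \<inter> Q \<subseteq> closure (tail s U) \<inter> Q"
            using closure_mono[OF tail_mono] by blast
        qed (use \<open>closed Q\<close> in \<open>auto simp: Q_def\<close>)
        with ne show False by blast
      qed
      then obtain x where "\<And>s. s \<in> T \<Longrightarrow> 0 \<le> s \<Longrightarrow> x \<in> closure (tail s U)" "x \<in> Q"
        using time_zero by blast
      then show "y \<in> \<phi> t ` \<omega> U"
        by (auto simp: omega_eq[OF assms] Q_def)
    qed
  qed
  then show ?thesis
    using omega_subset_space[OF assms] by (auto simp: invariant_def set_flow_def)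
qed

lemma invariant_subset_omega:
  assumes "invariant T X \<phi> S" "S \<subseteq> U" "U \<subseteq> X"
  shows "S \<subseteq> \<omega> U"
proof -
  have "S \<subseteq> closure (tail t U)" if "t \<in> T" "0 \<le> t" for t
  proof -
    have "S = \<phi> t ` S"
      using assms(1) that by (simp add: invariant_def set_flow_def)
    also have "\<dots> \<subseteq> tail t U"
      using assms(2) that by (auto simp: tail_def)
    finally show ?thesis
      using closure_subset by blast
  qed
  then show ?thesis
    by (auto simp: omega_eq[OF assms(3)])
qed

lemma omega_subset: "attracting U \<Longrightarrow> \<omega> U \<subseteq> U"
  using intr_subset[of X U] by (auto simp: attracting_nbhd_def)

text \<open>The limit set is invariant and contains every invariant subset of \<open>U\<close>.
  Allowing any \<open>S\<close> in between covers both \<open>S = U\<close>, for trapping regions,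
  and the intersection of two attractors, for meets.\<close>

lemma Inv_eq_omega:
  assumes "U \<subseteq> X" "\<omega> U \<subseteq> S" "S \<subseteq> U"
  shows "Inv T X \<phi> S = \<omega> U"
proof
  show "\<omega> U \<subseteq> Inv T X \<phi> S"
    using assms(2) omega_invariant[OF assms(1)] unfolding Inv_def by blast
  show "Inv T X \<phi> S \<subseteq> \<omega> U"
    unfolding Inv_def
  proof (rule Union_least)
    fix S' assume "S' \<in> {S'. S' \<subseteq> S \<and> invariant T X \<phi> S'}"
    then show "S' \<subseteq> \<omega> U"
      using assms by (intro invariant_subset_omega) auto
  qed
qed

lemma omega_mono: "U \<subseteq> V \<Longrightarrow> V \<subseteq> X \<Longrightarrow> \<omega> U \<subseteq> \<omega> V"
proof -
  assume UV: "U \<subseteq> V" "V \<subseteq> X"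
  then have "tail t U \<subseteq> tail t V" for t
    by (auto simp: tail_def)
  moreover have "U \<subseteq> X"
    using UV by simp
  ultimately show ?thesis
    unfolding omega_eq[OF UV(2)] omega_eq[OF \<open>U \<subseteq> X\<close>] by (intro INF_mono' closure_mono)
qed

lemma omega_Un:
  assumes "U \<subseteq> X" "V \<subseteq> X"
  shows "\<omega> (U \<union> V) = \<omega> U \<union> \<omega> V"
proof
  show "\<omega> (U \<union> V) \<subseteq> \<omega> U \<union> \<omega> V"
  proof (rule subsetI, rule ccontr)
    fix x assume x: "x \<in> \<omega> (U \<union> V)" "x \<notin> \<omega> U \<union> \<omega> V"
    then obtain s t where st: "s \<in> T" "0 \<le> s" "x \<notin> closure (tail s U)"
      "t \<in> T" "0 \<le> t" "x \<notin> closure (tail t V)"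
      by (auto simp: omega_eq assms)
    \<comment> \<open>At time \<open>s + t\<close> both tails lie inside those whose closures
      already miss \<open>x\<close>.\<close>
    have "tail (s + t) (U \<union> V) = tail (s + t) U \<union> tail (s + t) V"
      by (auto simp: tail_def)
    then have "closure (tail (s + t) (U \<union> V)) \<subseteq> closure (tail s U) \<union> closure (tail t V)"
      using st closure_mono[OF tail_mono[of s "s + t" U]] closure_mono[OF tail_mono[of t "s + t" V]]
      by auto
    moreover have "x \<in> closure (tail (s + t) (U \<union> V))"
      using x(1) st assms time_add by (auto simp: omega_eq)
    ultimately show False
      using st by auto
  qed
  show "\<omega> U \<union> \<omega> V \<subseteq> \<omega> (U \<union> V)"
    using assms by (intro Un_least omega_mono) auto
qed

lemma attracting_Un:
  assumes U: "attracting U" and V: "attracting V"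
  shows "attracting (U \<union> V)"
proof -
  have "\<omega> (U \<union> V) \<subseteq> intr X U \<union> intr X V"
    using assms by (auto simp: omega_Un attracting_nbhd_def)
  also have "\<dots> \<subseteq> intr X (U \<union> V)"
    by (intro Un_least intr_mono) auto
  finally show ?thesis
    using assms by (auto simp: attracting_nbhd_def)
qed

lemma attracting_Int:
  assumes U: "attracting U" and V: "attracting V"
  shows "attracting (U \<inter> V)"
proof -
  have "\<omega> (U \<inter> V) \<subseteq> \<omega> U \<inter> \<omega> V"
    using attracting_subset[OF U] attracting_subset[OF V] by (intro Int_greatest omega_mono) auto
  then show ?thesis
    using assms unfolding attracting_nbhd_def intr_Int by blast
qed

lemma attracting_empty: "attracting {}"
  and omega_empty: "\<omega> {} = {}"
proof -
  show "\<omega> {} = {}"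
    using time_zero by (force simp: omega_eq tail_def)
  then show "attracting {}"
    by (simp add: attracting_nbhd_def)
qed

lemma attracting_space: "attracting X"
  using omega_subset_space[of X] by (simp add: attracting_nbhd_def intr_eq)

lemma omega_Int:
  assumes U: "attracting U" and V: "attracting V"
  shows "\<omega> (U \<inter> V) = Inv T X \<phi> (\<omega> U \<inter> \<omega> V)"
proof (rule Inv_eq_omega[symmetric])
  show "U \<inter> V \<subseteq> X"
    using attracting_subset[OF U] by auto
  show "\<omega> (U \<inter> V) \<subseteq> \<omega> U \<inter> \<omega> V"
    using attracting_subset[OF U] attracting_subset[OF V] by (intro Int_greatest omega_mono) auto
  show "\<omega> U \<inter> \<omega> V \<subseteq> U \<inter> V"
    using omega_subset[OF U] omega_subset[OF V] by auto
qed

lemma basin_subset: "basin U \<subseteq> X"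
  by (auto simp: basin_def)

lemma basin_empty: "basin {} = {}"
  by (simp add: basin_def)

lemma basin_space: "basin X = X"
  using flow_zero time_zero by (force simp: basin_def)

lemma basin_Un: "basin (U \<union> V) = basin U \<union> basin V"
  by (auto simp: basin_def)

text \<open>An orbit may visit \<open>U\<close> and \<open>V\<close> at different times, but each
  eventually keeps it; at the late time \<open>r\<close> both hold.\<close>

lemma basin_Int:
  assumes U: "attracting U" and V: "attracting V"
  shows "basin (U \<inter> V) = basin U \<inter> basin V"
proof
  show "basin (U \<inter> V) \<subseteq> basin U \<inter> basin V"
    by (auto simp: basin_def)
  obtain \<tau> where \<tau>: "\<tau> \<in> T" "0 \<le> \<tau>"
    "\<And>t x. t \<in> T \<Longrightarrow> \<tau> \<le> t \<Longrightarrow> x \<in> closure U \<Longrightarrow> \<phi> t x \<in> intr X U"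
    using U by (rule attractingE) blast
  obtain \<sigma> where \<sigma>: "\<sigma> \<in> T" "0 \<le> \<sigma>"
    "\<And>t x. t \<in> T \<Longrightarrow> \<sigma> \<le> t \<Longrightarrow> x \<in> closure V \<Longrightarrow> \<phi> t x \<in> intr X V"
    using V by (rule attractingE) blast
  show "basin U \<inter> basin V \<subseteq> basin (U \<inter> V)"
  proof
    fix x assume "x \<in> basin U \<inter> basin V"
    then obtain s t where x: "x \<in> X" and s: "s \<in> T" "0 \<le> s" "\<phi> s x \<in> U"
      and t: "t \<in> T" "0 \<le> t" "\<phi> t x \<in> V"
      by (auto simp: basin_def)
    define r where "r = s + t + \<tau> + \<sigma>"
    have r: "r \<in> T" "0 \<le> r" "s \<le> r" "t \<le> r"
      using s t \<tau> \<sigma> by (auto simp: r_def intro!: time_add)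
    have "\<phi> (r - s) (\<phi> s x) \<in> intr X U"
      using r s t \<tau> \<sigma> closure_subset[of U] by (intro \<tau>(3) time_diff) (auto simp: r_def)
    moreover have "\<phi> (r - t) (\<phi> t x) \<in> intr X V"
      using r s t \<tau> \<sigma> closure_subset[of V] by (intro \<sigma>(3) time_diff) (auto simp: r_def)
    ultimately have "\<phi> r x \<in> U \<inter> V"
      using flow_split[of s r x] flow_split[of t r x] r s t x intr_subset[of X U] intr_subset[of X V]
      by auto
    then show "x \<in> basin (U \<inter> V)"
      using x r by (auto simp: basin_def)
  qed
qed

subsection \<open>Trapping and repelling regions\<close>

text \<open>Forward invariance spreads the one trapping time to all later ones: the excess
  \<open>t - \<tau>\<close> is spent first and keeps points in \<open>closure U\<close>.\<close>

lemma trapping_imp_attracting: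
  assumes "trapping_region T X \<phi> U"
  shows "attracting U"
proof -
  obtain \<tau> where U: "U \<subseteq> X" and fwd: "\<And>t. t \<in> T \<Longrightarrow> 0 \<le> t \<Longrightarrow> \<phi> t ` U \<subseteq> U"
    and \<tau>: "\<tau> \<in> T" "0 < \<tau>" "\<phi> \<tau> ` closure U \<subseteq> intr X U"
    using assms by (auto simp: trapping_region_def forward_invariant_def set_flow_def
        cl_eq_closure[OF closed_space])
  have "\<phi> t x \<in> intr X U" if "t \<in> T" "\<tau> \<le> t" "x \<in> closure U" for t x
  proof -
    have t: "t - \<tau> \<in> T" "0 \<le> t - \<tau>"
      using that \<tau> time_diff by auto
    have "\<phi> (t - \<tau>) ` closure U \<subseteq> closure U"
      using flow_closure[OF t U] closure_mono[OF fwd[OF t]] by blast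
    then have "\<phi> \<tau> (\<phi> (t - \<tau>) x) \<in> intr X U"
      using that \<tau>(3) by auto
    then show ?thesis
      using flow_flow[OF t(1) \<tau>(1) t(2), of x] \<tau>(2) that closure_subset_space[OF U] by auto
  qed
  then show ?thesis
    unfolding attracting_iff absorbs_def using U \<tau> by (force intro!: bexI[of _ \<tau>])
qed

lemma attracting_imp_trapping:
  assumes "attracting U"
  obtains V where "trapping_region T X \<phi> V" "\<omega> V = \<omega> U"
proof -
  have U: "U \<subseteq> X"
    using assms by (rule attracting_subset)
  obtain \<tau> where \<tau>: "\<tau> \<in> T" "0 \<le> \<tau>"
    "\<And>t x. t \<in> T \<Longrightarrow> \<tau> \<le> t \<Longrightarrow> x \<in> closure U \<Longrightarrow> \<phi> t x \<in> intr X U"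
    using assms by (rule attractingE) blast
  \<comment> \<open>The forward orbit of \<open>U\<close> is forward invariant, and attraction
    brings all of it back into \<open>U\<close> after time \<open>\<tau>\<close>, so the limit set
    is unchanged.\<close>
  define V where "V = tail 0 U"
  have V: "V \<subseteq> X"
    unfolding V_def using U by (rule tail_subset) simp
  have UV: "U \<subseteq> V"
  proof
    fix x assume "x \<in> U"
    then show "x \<in> V"
      using U flow_zero[of x] time_zero by (force simp: V_def tail_def)
  qed
  have fwd: "\<phi> t ` V \<subseteq> V" if "t \<in> T" "0 \<le> t" for t
  proof
    fix y assume "y \<in> \<phi> t ` V"
    then obtain s x where "s \<in> T" "0 \<le> s" "x \<in> U" "y = \<phi> t (\<phi> s x)"
      by (auto simp: V_def tail_def)
    then show "y \<in> V"
      using that U flow_flow[of s t x] time_add[of t s]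
      by (auto simp: V_def tail_def intro!: exI[of _ "t + s"])
  qed
  have VU: "\<phi> t x \<in> U" if t: "t \<in> T" "\<tau> \<le> t" "x \<in> V" for t x
  proof -
    obtain s y where s: "s \<in> T" "0 \<le> s" "y \<in> U" "x = \<phi> s y"
      using t(3) by (auto simp: V_def tail_def)
    then have "\<phi> (t + s) y \<in> intr X U"
      using t closure_subset[of U] by (intro \<tau>(3) time_add) auto
    then show ?thesis
      using s t \<tau>(2) subsetD[OF U] flow_flow[of s t y] subsetD[OF intr_subset[of X U]] by auto
  qed
  \<comment> \<open>A trapping time must be positive, while \<open>\<tau>\<close> may be 0.\<close>
  define \<sigma> where "\<sigma> = \<tau> + 1"
  have \<sigma>: "\<sigma> \<in> T" "0 < \<sigma>" "\<tau> \<le> \<sigma>"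
    using \<tau> time_add[of \<tau> 1] time_of_nat[of 1] by (auto simp: \<sigma>_def)
  \<comment> \<open>Doubled: the first \<open>\<sigma>\<close> takes \<open>closure V\<close> to
    \<open>closure U\<close>, the second takes that to the interior of \<open>U\<close>.\<close>
  have "\<phi> (\<sigma> + \<sigma>) ` closure V \<subseteq> intr X V"
  proof
    fix y assume "y \<in> \<phi> (\<sigma> + \<sigma>) ` closure V"
    then obtain x where x: "x \<in> closure V" "y = \<phi> (\<sigma> + \<sigma>) x" by auto
    have "\<phi> \<sigma> ` closure V \<subseteq> closure (\<phi> \<sigma> ` V)"
      using \<sigma> V by (intro flow_closure) auto
    also have "\<dots> \<subseteq> closure U"
      using VU \<sigma> by (intro closure_mono) auto
    finally have "\<phi> \<sigma> (\<phi> \<sigma> x) \<in> intr X U"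
      using x \<sigma> by (intro \<tau>(3)) auto
    then show "y \<in> intr X V"
      using x \<sigma> flow_flow[of \<sigma> \<sigma> x] subsetD[OF closure_subset_space[OF V]]
        subsetD[OF intr_mono[OF UV, of X]] by auto
  qed
  then have "trapping_region T X \<phi> V"
    using V fwd \<sigma> time_add[of \<sigma> \<sigma>]
    by (auto simp: trapping_region_def forward_invariant_def set_flow_def
        cl_eq_closure[OF closed_space] intro!: bexI[of _ "\<sigma> + \<sigma>"])
  moreover have "\<omega> V = \<omega> U"
  proof
    have "absorbs U V"
      using VU \<tau> by (auto simp: absorbs_def)
    then show "\<omega> V \<subseteq> \<omega> U"
      using U V by (intro absorbs_imp_omega_subset)
    show "\<omega> U \<subseteq> \<omega> V"
      using UV V by (rule omega_mono)
  qed
  ultimately show ?thesis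
    by (rule that)
qed

lemma attractors_eq: "attractors T X \<phi> = \<omega> ` {U. attracting U}"
proof (intro subset_antisym subsetI)
  fix A assume "A \<in> attractors T X \<phi>"
  then obtain U where "trapping_region T X \<phi> U" "A = Inv T X \<phi> U"
    by (auto simp: attractors_def)
  then have "attracting U" "A = \<omega> U"
    using trapping_imp_attracting[of U] Inv_eq_omega[of U U] omega_subset[of U]
      attracting_subset[of U] by auto
  then show "A \<in> \<omega> ` {U. attracting U}"
    by auto
next
  fix A assume "A \<in> \<omega> ` {U. attracting U}"
  then obtain U where "attracting U" "A = \<omega> U"
    by auto
  then obtain V where "trapping_region T X \<phi> V" "A = \<omega> V"
    using attracting_imp_trapping by metis
  moreover have "attracting V"
    using \<open>trapping_region T X \<phi> V\<close> by (rule trapping_imp_attracting)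
  ultimately have "trapping_region T X \<phi> V" "A = Inv T X \<phi> V"
    using Inv_eq_omega[of V V] omega_subset[of V] attracting_subset[of V] by auto
  then show "A \<in> attractors T X \<phi>"
    by (auto simp: attractors_def)
qed

text \<open>The form in which \<open>repelling_dual_attracting\<close> describes alpha limits, and
  to which the complement of a basin unfolds.\<close>

lemma Inv_plus_eq:
  assumes "U \<subseteq> X"
  shows "Inv_plus T X \<phi> U = {x\<in>X. \<forall>t\<in>T. 0 \<le> t \<longrightarrow> \<phi> t x \<in> U}" (is "_ = ?D")
proof
  show "Inv_plus T X \<phi> U \<subseteq> ?D"
    using assms by (fastforce simp: Inv_plus_def forward_invariant_def set_flow_def)
  have "?D \<subseteq> U"
    using flow_zero time_zero by force
  moreover have "forward_invariant T X \<phi> ?D"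
    using flow_in flow_flow time_add by (auto simp: forward_invariant_def set_flow_def)
  ultimately show "?D \<subseteq> Inv_plus T X \<phi> U"
    unfolding Inv_plus_def by blast
qed

text \<open>Backward invariance collapses all preimages beyond time \<open>\<tau>\<close> into the
  preimage of \<open>closure V\<close> at \<open>\<tau>\<close>, a closed set inside the
  interior.\<close>

lemma repelling_region_imp_repelling:
  assumes "repelling_region T X \<phi> V"
  shows "repelling V"
proof -
  have V: "V \<subseteq> X" and bwd: "\<And>t. t \<in> T \<Longrightarrow> t \<le> 0 \<Longrightarrow> set_flow X \<phi> t V \<subseteq> V"
    using assms by (auto simp: repelling_region_def backward_invariant_def)
  obtain \<sigma> where \<sigma>: "\<sigma> \<in> T" "\<sigma> < 0" "set_flow X \<phi> \<sigma> (cl X V) \<subseteq> intr X V"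
    using assms by (auto simp: repelling_region_def)
  define \<tau> where "\<tau> = - \<sigma>"
  have \<tau>: "\<tau> \<in> T" "0 < \<tau>"
    using \<sigma> by (auto simp: \<tau>_def time_minus)
  have pre: "{x\<in>X. \<phi> \<tau> x \<in> closure V} \<subseteq> intr X V"
    using \<sigma> by (auto simp: \<tau>_def set_flow_def cl_eq_closure[OF closed_space V])
  have bwd': "x \<in> V" if "t \<in> T" "0 \<le> t" "x \<in> X" "\<phi> t x \<in> V" for t x
  proof (cases "t = 0")
    case True
    then show ?thesis
      using that flow_zero by simp
  next
    case False
    then show ?thesis
      using bwd[of "- t"] that by (auto simp: set_flow_def time_minus)
  qed
  have "pretail \<tau> V \<subseteq> {x\<in>X. \<phi> \<tau> x \<in> closure V}"
  proof
    fix x assume "x \<in> pretail \<tau> V"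
    then obtain s where s: "x \<in> X" "s \<in> T" "\<tau> \<le> s" "\<phi> s x \<in> V"
      by (auto simp: pretail_def)
    then have "\<phi> \<tau> x \<in> V"
      using \<tau> flow_split[of \<tau> s x] flow_in[of \<tau> x] time_diff[of s \<tau>] bwd'[of "s - \<tau>" "\<phi> \<tau> x"]
      by auto
    then show "x \<in> {x\<in>X. \<phi> \<tau> x \<in> closure V}"
      using s closure_subset by auto
  qed
  then have "closure (pretail \<tau> V) \<subseteq> {x\<in>X. \<phi> \<tau> x \<in> closure V}"
    using \<tau> by (intro closure_minimal closed_preimage) auto
  moreover have "\<alpha> V \<subseteq> closure (pretail \<tau> V)"
    using \<tau> by (auto simp: alpha_eq[OF V])
  ultimately show ?thesis
    using V pre by (auto simp: repelling_nbhd_def)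
qed

text \<open>Preimages commute with complements, which exchange closure and interior, so the same
  time works with its sign reversed.\<close>

lemma trapping_compl:
  assumes "trapping_region T X \<phi> U"
  shows "repelling_region T X \<phi> (X - U)"
proof -
  obtain \<tau> where U: "U \<subseteq> X" and fwd: "\<And>t. t \<in> T \<Longrightarrow> 0 \<le> t \<Longrightarrow> \<phi> t ` U \<subseteq> U"
    and \<tau>: "\<tau> \<in> T" "0 < \<tau>" "\<phi> \<tau> ` cl X U \<subseteq> intr X U"
    using assms by (auto simp: trapping_region_def forward_invariant_def set_flow_def)
  have "set_flow X \<phi> t (X - U) \<subseteq> X - U" if t: "t \<in> T" "t \<le> 0" for t
  proof (cases "t = 0")
    case True
    then show ?thesis
      using flow_zero by (auto simp: set_flow_def)
  next
    case False
    then show ?thesis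
      using t fwd[of "- t"] by (auto simp: set_flow_def time_minus)
  qed
  moreover have "set_flow X \<phi> (- \<tau>) (cl X (X - U)) \<subseteq> intr X (X - U)"
    using \<tau> by (auto simp: set_flow_def cl_Diff intr_Diff)
  ultimately show ?thesis
    using \<tau> unfolding repelling_region_def backward_invariant_def
    by (auto simp: time_minus intro!: bexI[of _ "- \<tau>"])
qed

lemma repellers_eq: "repellers T X \<phi> = (\<lambda>U. X - basin U) ` {U. attracting U}"
proof (intro subset_antisym subsetI)
  fix R assume "R \<in> repellers T X \<phi>"
  then obtain V where V: "repelling_region T X \<phi> V" "R = Inv_plus T X \<phi> V"
    by (auto simp: repellers_def)
  then have "repelling V"
    by (intro repelling_region_imp_repelling)
  then obtain N where "attracting N" "\<alpha> V = X - basin N"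
      "\<alpha> V = {x\<in>X. \<forall>t\<in>T. 0 \<le> t \<longrightarrow> \<phi> t x \<in> V}"
    by (rule repelling_dual_attracting)
  then show "R \<in> (\<lambda>U. X - basin U) ` {U. attracting U}"
    using V \<open>repelling V\<close> by (auto simp: repelling_nbhd_def Inv_plus_eq)
next
  fix R assume "R \<in> (\<lambda>U. X - basin U) ` {U. attracting U}"
  then obtain U where U: "attracting U" "R = X - basin U"
    by auto
  \<comment> \<open>The complement of \<open>U\<close> need not be backward invariant. A trapping
    region with the same limit set has the same basin, and its complement is a repelling
    region.\<close>
  then obtain V where V: "trapping_region T X \<phi> V" "\<omega> V = \<omega> U"
    using attracting_imp_trapping by metis
  then have "basin V = basin U"
    using U trapping_imp_attracting by (simp add: omega_eq_iff)
  then have "R = Inv_plus T X \<phi> (X - V)"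
    using U flow_in by (auto simp: Inv_plus_eq basin_def)
  then show "R \<in> repellers T X \<phi>"
    using trapping_compl[OF V(1)] by (auto simp: repellers_def)
qed

subsection \<open>Duality\<close>

lemma att_dual_omega:
  assumes "attracting U"
  shows "att_dual T X \<phi> (\<omega> U) = X - basin U"
  unfolding att_dual_def
proof (rule the_equality)
  show "\<exists>U'. attracting U' \<and> \<omega> U' = \<omega> U \<and> X - basin U = \<alpha> (X - U')"
    using assms alpha_compl by metis
next
  fix R assume "\<exists>U'. attracting U' \<and> \<omega> U' = \<omega> U \<and> R = \<alpha> (X - U')"
  then show "R = X - basin U"
    using assms by (auto simp: omega_eq_iff alpha_compl)
qed

text \<open>Here \<open>V\<close> is any repelling neighborhood, so \<open>X - V\<close> may fail to
  be attracting; the fattened \<open>N\<close> is compared with \<open>U\<close> through their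
  basins.\<close>

lemma omega_compl_repelling:
  assumes "attracting U" "repelling V" "\<alpha> V = X - basin U"
  shows "\<omega> (X - V) = \<omega> U"
proof -
  obtain N where N: "attracting N" "\<omega> N = \<omega> (X - V)" "\<alpha> V = X - basin N"
    using assms(2) by (rule repelling_dual_attracting)
  then have "basin N = basin U"
    using assms(3) basin_subset[of N] basin_subset[of U] by blast
  then show ?thesis
    using N assms(1) omega_eq_iff by metis
qed

lemma rep_dual_compl_basin:
  assumes "attracting U"
  shows "rep_dual T X \<phi> (X - basin U) = \<omega> U"
  unfolding rep_dual_def
proof (rule the_equality)
  have "\<omega> (X - (X - U)) = \<omega> U"
    using attracting_subset[OF assms] by (simp add: double_diff)
  then show "\<exists>V. repelling V \<and> \<alpha> V = X - basin U \<and> \<omega> U = \<omega> (X - V)"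
    using repelling_compl[OF assms] alpha_compl[OF assms] by metis
next
  fix A assume "\<exists>V. repelling V \<and> \<alpha> V = X - basin U \<and> A = \<omega> (X - V)"
  then show "A = \<omega> U"
    using omega_compl_repelling[OF assms] by auto
qed

section \<open>Both lattices computed on representing neighborhoods\<close>

lemma Att_sel:
  "elems (Att T X \<phi>) = \<omega> ` {U. attracting U}"
  "attracting U \<Longrightarrow> attracting V \<Longrightarrow> join (Att T X \<phi>) (\<omega> U) (\<omega> V) = \<omega> (U \<union> V)"
  "attracting U \<Longrightarrow> attracting V \<Longrightarrow> meet (Att T X \<phi>) (\<omega> U) (\<omega> V) = \<omega> (U \<inter> V)"
  "zero (Att T X \<phi>) = \<omega> {}"
  "one (Att T X \<phi>) = \<omega> X"
  using omega_subset_space[of X]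
  by (simp_all add: Att_def attractors_eq omega_Un attracting_subset omega_Int omega_empty
      Inv_eq_omega)

text \<open>Complements of basins turn unions into intersections and conversely. With
  \<open>Att_sel\<close>, lattice laws and anti-isomorphism reduce to set identities between
  attracting neighborhoods.\<close>

lemma Rep_sel:
  "elems (Rep T X \<phi>) = (\<lambda>U. X - basin U) ` {U. attracting U}"
  "attracting U \<Longrightarrow> attracting V \<Longrightarrow>
    join (Rep T X \<phi>) (X - basin U) (X - basin V) = X - basin (U \<inter> V)"
  "attracting U \<Longrightarrow> attracting V \<Longrightarrow>
    meet (Rep T X \<phi>) (X - basin U) (X - basin V) = X - basin (U \<union> V)"
  "zero (Rep T X \<phi>) = X - basin X"
  "one (Rep T X \<phi>) = X - basin {}"
  by (auto simp: Rep_def repellers_eq basin_Un basin_Int basin_empty basin_space)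

lemma Att_lattice: "bounded_distributive_lattice (Att T X \<phi>)"
proof -
  have [simp]: "U \<inter> X = U" if "attracting U" for U
    using attracting_subset[OF that] by auto
  show ?thesis
    unfolding bounded_distributive_lattice_def Att_sel(1,4,5)
    by (simp add: Att_sel(2,3) attracting_Un attracting_Int attracting_empty attracting_space
        imageI Un_assoc Int_assoc Int_Un_distrib)
      (simp add: Un_commute Int_commute)
qed

lemma Rep_lattice: "bounded_distributive_lattice (Rep T X \<phi>)"
proof -
  have [simp]: "U \<inter> X = U" if "attracting U" for U
    using attracting_subset[OF that] by auto
  show ?thesis
    unfolding bounded_distributive_lattice_def Rep_sel(1,4,5)
    by (simp add: Rep_sel(2,3) attracting_Un attracting_Int attracting_empty attracting_space
        imageI Un_assoc Int_assoc Un_Int_distrib)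
      (simp add: Un_commute Int_commute)
qed

lemma att_dual_anti_isomorphism:
  "lattice_anti_isomorphism (Att T X \<phi>) (Rep T X \<phi>) (att_dual T X \<phi>)"
proof -
  have "bij_betw (att_dual T X \<phi>) (elems (Att T X \<phi>)) (elems (Rep T X \<phi>))"
    by (rule bij_betw_byWitness[where f' = "rep_dual T X \<phi>"])
      (auto simp: Att_sel(1) Rep_sel(1) att_dual_omega rep_dual_compl_basin)
  then show ?thesis
    unfolding lattice_anti_isomorphism_def
    by (auto simp: Att_lattice Rep_lattice Att_sel Rep_sel att_dual_omega attracting_Un
        attracting_Int attracting_empty attracting_space simp del: Diff_cancel)
qed

lemma rep_dual_anti_isomorphism:
  "lattice_anti_isomorphism (Rep T X \<phi>) (Att T X \<phi>) (rep_dual T X \<phi>)"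
proof -
  have "bij_betw (rep_dual T X \<phi>) (elems (Rep T X \<phi>)) (elems (Att T X \<phi>))"
    by (rule bij_betw_byWitness[where f' = "att_dual T X \<phi>"])
      (auto simp: Att_sel(1) Rep_sel(1) att_dual_omega rep_dual_compl_basin)
  then show ?thesis
    unfolding lattice_anti_isomorphism_def
    by (auto simp: Att_lattice Rep_lattice Att_sel Rep_sel rep_dual_compl_basin attracting_Un
        attracting_Int attracting_empty attracting_space simp del: Diff_cancel)
qed

end

theorem proposition4p7:
  fixes T :: "real set" and X :: "'a::metric_space set" and \<phi> :: "real \<Rightarrow> 'a \<Rightarrow> 'a"
  assumes "T = \<int> \<or> T = UNIV"
    and "compact X"
    and "dynamical_system T X \<phi>"
  shows "(\<forall>A\<in>elems (Att T X \<phi>).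
            (\<exists>U. attracting_nbhd T X \<phi> U \<and> omega_limit T X \<phi> U = A) \<and>
            (\<forall>U. attracting_nbhd T X \<phi> U \<and> omega_limit T X \<phi> U = A \<longrightarrow>
               att_dual T X \<phi> A = alpha_limit T X \<phi> (X - U))) \<and>
         (\<forall>R\<in>elems (Rep T X \<phi>).
            (\<exists>U. repelling_nbhd T X \<phi> U \<and> alpha_limit T X \<phi> U = R) \<and>
            (\<forall>U. repelling_nbhd T X \<phi> U \<and> alpha_limit T X \<phi> U = R \<longrightarrow>
               rep_dual T X \<phi> R = omega_limit T X \<phi> (X - U))) \<and>
         lattice_anti_isomorphism (Att T X \<phi>) (Rep T X \<phi>) (att_dual T X \<phi>) \<and>
         lattice_anti_isomorphism (Rep T X \<phi>) (Att T X \<phi>) (rep_dual T X \<phi>) \<and>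
         (\<forall>A\<in>elems (Att T X \<phi>). rep_dual T X \<phi> (att_dual T X \<phi> A) = A) \<and>
         (\<forall>R\<in>elems (Rep T X \<phi>). att_dual T X \<phi> (rep_dual T X \<phi> R) = R)"
proof -
  interpret compact_semiflow T X \<phi>
    using assms by unfold_locales
  have "(\<exists>U. attracting U \<and> \<omega> U = A) \<and>
      (\<forall>U. attracting U \<and> \<omega> U = A \<longrightarrow> att_dual T X \<phi> A = \<alpha> (X - U))"
    if A: "A \<in> elems (Att T X \<phi>)" for A
  proof -
    obtain U where "attracting U" "\<omega> U = A"
      using A by (auto simp: Att_sel(1))
    moreover have "att_dual T X \<phi> A = \<alpha> (X - U)" if "attracting U" "\<omega> U = A" for U
      using that att_dual_omega[of U] alpha_compl[of U] by simp
    ultimately show ?thesis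
      by blast
  qed
  moreover have "(\<exists>V. repelling V \<and> \<alpha> V = R) \<and>
      (\<forall>V. repelling V \<and> \<alpha> V = R \<longrightarrow> rep_dual T X \<phi> R = \<omega> (X - V))"
    if R: "R \<in> elems (Rep T X \<phi>)" for R
  proof -
    obtain U where U: "attracting U" "R = X - basin U"
      using R by (auto simp: Rep_sel(1))
    then show ?thesis
      using repelling_compl[of U] alpha_compl[of U] omega_compl_repelling[of U]
        rep_dual_compl_basin[of U] by auto
  qed
  moreover have "rep_dual T X \<phi> (att_dual T X \<phi> A) = A" if "A \<in> elems (Att T X \<phi>)" for A
    using that by (auto simp: Att_sel(1) att_dual_omega rep_dual_compl_basin)
  moreover have "att_dual T X \<phi> (rep_dual T X \<phi> R) = R" if "R \<in> elems (Rep T X \<phi>)" for R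
    using that by (auto simp: Rep_sel(1) att_dual_omega rep_dual_compl_basin)
  ultimately show ?thesis
    by (simp add: att_dual_anti_isomorphism rep_dual_anti_isomorphism)
qed

end
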